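(* There are infinitely many (pairwise non-congruent) pairs of amicable Heronian parallelograms. That is, up to congruence there are infinitely many pairs $(H, C)$ of Heronian parallelograms such that the area of $H$ equals the perimeter of $C$ and the area of $C$ equals the perimeter of $H$.
   Context: Parallelograms are (nondegenerate) parallelograms in the Euclidean plane. A convex polygon is Heronian if its side lengths are integers and its area is also an integer (the diagonals are not required to be integers). Two polygons are amicable if the area of one equals the perimeter of the other, and vice versa. *)

theory Defs
  imports "HOL-Analysis.Analysis"
begin

text \<open>
  A polygon in the Euclidean plane is given by the list of its vertices in cyclic order.
  Only convex polygons are considered, so the region it bounds is the convex hull
  of the vertices.
\<close>

type_synonym polygon = "(real^2) list"

definition region :: "polygon \<Rightarrow> (real^2) set" where
  "region P = convex hull (set P)"

definition side_length :: "polygon \<Rightarrow> nat \<Rightarrow> real" where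
  "side_length P i = dist (P ! i) (P ! (Suc i mod length P))"

definition perimeter :: "polygon \<Rightarrow> real" where
  "perimeter P = (\<Sum>i<length P. side_length P i)"

definition area :: "polygon \<Rightarrow> real" where
  "area P = measure lebesgue (region P)"

definition parallelogram :: "polygon \<Rightarrow> bool" where
  "parallelogram P \<longleftrightarrow>
     (\<exists>A B C D. P = [A, B, C, D] \<and> B - A = C - D \<and> \<not> collinear {A, B, C})"

definition heronian :: "polygon \<Rightarrow> bool" where
  "heronian P \<longleftrightarrow> (\<forall>i<length P. side_length P i \<in> \<int>) \<and> area P \<in> \<int>"

definition amicable :: "polygon \<Rightarrow> polygon \<Rightarrow> bool" where
  "amicable P Q \<longleftrightarrow> area P = perimeter Q \<and> area Q = perimeter P"

text \<open>
  Congruence compares regions, so it does not depend on which vertex is listed first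
  or on the orientation. A distance-preserving map of the plane is automatically bijective;
  reflections are allowed.
\<close>

definition congruent_polygons :: "polygon \<Rightarrow> polygon \<Rightarrow> bool" where
  "congruent_polygons P Q \<longleftrightarrow>
     (\<exists>f :: real^2 \<Rightarrow> real^2. (\<forall>x y. dist (f x) (f y) = dist x y) \<and> f ` region P = region Q)"

definition congruent_pairs :: "polygon \<times> polygon \<Rightarrow> polygon \<times> polygon \<Rightarrow> bool" where
  "congruent_pairs p q \<longleftrightarrow>
     congruent_polygons (fst p) (fst q) \<and> congruent_polygons (snd p) (snd q)"

end

theory Submission
  imports Defs
begin

text \<open>
  The integrality conditions leave the angle of a parallelogram free: with sides \<open>a\<close> and \<open>b\<close>,
  the area sweeps out all of \<open>(0, a * b]\<close> as the angle varies, so every positive integer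
  \<open>k \<le> a * b\<close> is the area of a Heronian parallelogram with these sides
  (\<open>heronian_parallelogram_exists\<close>). For two rhombi of sides \<open>s\<close> and \<open>s + 1\<close>, amicability
  only asks for the areas \<open>4 * (s + 1)\<close> and \<open>4 * s\<close>, and both are attainable as soon as
  \<open>s \<ge> 5\<close>. This gives one amicable pair for each such \<open>s\<close>.

  Since congruent polygons have equal areas (\<open>congruent_polygons_area_eq\<close>), the two members of a
  pair are not congruent, and neither are the first members of two different pairs.
\<close>

text \<open>
  After subtracting the image of the origin, a distance-preserving map of the plane is an
  orthogonal linear map; both it and the translation preserve Lebesgue measure.
\<close>
lemma congruent_polygons_area_eq:
  assumes "congruent_polygons P Q"
  shows "area P = area Q"
proof -
  obtain f :: "real^2 \<Rightarrow> real^2"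
    where iso: "\<And>x y. dist (f x) (f y) = dist x y" and im: "f ` region P = region Q"
    using assms unfolding congruent_polygons_def by blast
  define g where "g x = f x - f 0" for x
  have "orthogonal_transformation g"
    unfolding orthogonal_transformation_isometry using iso by (simp add: g_def dist_norm)
  moreover have "region P \<in> lmeasurable"
    unfolding region_def
    by (intro lmeasurable_compact compact_convex_hull finite_imp_compact) simp
  ultimately have "measure lebesgue (g ` region P) = measure lebesgue (region P)"
    by (rule measure_orthogonal_image)
  moreover have "region Q = (+) (f 0) ` (g ` region P)"
    unfolding im[symmetric] g_def by (auto simp: image_image)
  ultimately show ?thesis
    by (simp add: area_def measure_translation)
qed

text \<open>
  The parallelogram is the image of the unit square under the linear map with columns \<open>u\<close> and
  \<open>v\<close>, and the right-hand side is the absolute determinant of that map.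
\<close>
lemma measure_convex_hull_parallelogram:
  fixes u v :: "real^2"
  shows "measure lebesgue (convex hull {0, u, u + v, v}) = \<bar>u$1 * v$2 - v$1 * u$2\<bar>"
proof -
  define f :: "real^2 \<Rightarrow> real^2" where "f x = x$1 *\<^sub>R u + x$2 *\<^sub>R v" for x
  have lin: "linear f"
    by (auto simp: f_def linear_iff algebra_simps)
  have "{x :: real^2. \<forall>i\<in>Basis. x \<bullet> i = 0 \<or> x \<bullet> i = 1} = {x. \<forall>i. x$i = 0 \<or> x$i = 1}"
    by (simp add: Basis_vec_def inner_axis)
  also have "\<dots> = {0, axis 1 1, axis 1 1 + axis 2 1, axis 2 1}"
    by (auto simp: vec_eq_iff forall_2 axis_def)
  finally have corners: "{x :: real^2. \<forall>i\<in>Basis. x \<bullet> i = 0 \<or> x \<bullet> i = 1} =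
      {0, axis 1 1, axis 1 1 + axis 2 1, axis 2 1}" .
  have "convex hull {0, u, u + v, v} = convex hull (f ` {0, axis 1 1, axis 1 1 + axis 2 1, axis 2 1})"
    by (simp add: f_def axis_def)
  also have "\<dots> = f ` cbox 0 One"
    using lin by (simp only: convex_hull_linear_image unit_interval_convex_hull corners)
  finally have "measure lebesgue (convex hull {0, u, u + v, v}) =
      \<bar>det (matrix f)\<bar> * measure lebesgue (cbox 0 One :: (real^2) set)"
    using lin by (simp add: measure_linear_image)
  also have "measure lebesgue (cbox 0 One :: (real^2) set) = 1"
    by simp
  also have "det (matrix f) = u$1 * v$2 - v$1 * u$2"
    by (simp add: det_2 matrix_def f_def axis_def)
  finally show ?thesis by simp
qed

text \<open>
  Over the base \<open>a\<close> the height has to be \<open>h = k / a\<close>, and the bound \<open>k \<le> a * b\<close> says that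
  \<open>h \<le> b\<close>, which is what lets a slanted side of length \<open>b\<close> reach that height.
  A rational height suffices, and the slant \<open>sqrt (b\<^sup>2 - h\<^sup>2)\<close> may be irrational.
\<close>
lemma heronian_parallelogram_exists:
  fixes a b k :: nat
  assumes "0 < k" "k \<le> a * b"
  obtains P where "parallelogram P" "heronian P" "area P = k" "perimeter P = 2 * (a + b)"
proof -
  have pos: "0 < a" "0 < b"
    using assms by (auto intro: Nat.gr0I)
  define h where "h = k / a"
  have h: "0 < h" "h \<le> b" "a * h = k"
    using assms pos by (auto simp: h_def field_simps simp flip: of_nat_mult)
  define u v :: "real^2" where "u = vector [a, 0]" and "v = vector [sqrt (b\<^sup>2 - h\<^sup>2), h]"
  define P where "P = [0, u, u + v, v]"
  have comps [simp]: "u$1 = a" "u$2 = 0" "v$1 = sqrt (b\<^sup>2 - h\<^sup>2)" "v$2 = h"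
    by (simp_all add: u_def v_def)
  have norms: "norm u = a" "norm v = b"
    using h by (simp_all add: norm_vec_def L2_set_def sum_2)
  have sides: "side_length P 0 = a" "side_length P 1 = b"
      "side_length P 2 = a" "side_length P 3 = b"
    using norms by (simp_all add: side_length_def P_def dist_norm norm_minus_commute)
  have area: "area P = k"
    using h by (simp add: area_def region_def P_def measure_convex_hull_parallelogram)
  have "\<not> collinear {0, u, u + v}"
  proof
    assume "collinear {0, u, u + v}"
    moreover have "u \<noteq> 0"
      using norms pos by auto
    ultimately obtain c where "u + v = c *\<^sub>R u"
      by (auto simp: collinear_lemma)
    then have "(u + v)$2 = (c *\<^sub>R u)$2"
      by simp
    then show False
      using h by simp
  qed
  then have "parallelogram P"
    unfolding parallelogram_def P_def by force
  moreover have "heronian P"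
    unfolding heronian_def area using sides
    by (auto simp: P_def less_Suc_eq numeral_eq_Suc)
  moreover have "perimeter P = 2 * (a + b)"
    using sides by (simp add: perimeter_def P_def numeral_eq_Suc)
  ultimately show thesis
    using that area by blast
qed

theorem mainTheorem2:
  "\<exists>S :: (polygon \<times> polygon) set.
     infinite S \<and>
     pairwise (\<lambda>p q. \<not> congruent_pairs p q) S \<and>
     (\<forall>(H, C) \<in> S.
        parallelogram H \<and> heronian H \<and>
        parallelogram C \<and> heronian C \<and>
        \<not> congruent_polygons H C \<and>
        amicable H C)"
proof -
  have "\<exists>P. parallelogram P \<and> heronian P \<and> area P = k \<and> perimeter P = 2 * (s + s)"
    if "0 < k" "k \<le> s * s" for k s :: nat
    using heronian_parallelogram_exists[OF that] by metis
  then obtain R :: "nat \<Rightarrow> nat \<Rightarrow> polygon" where R: "\<And>k s. 0 < k \<Longrightarrow> k \<le> s * s \<Longrightarrow>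
      parallelogram (R k s) \<and> heronian (R k s) \<and> area (R k s) = k \<and> perimeter (R k s) = 2 * (s + s)"
    by metis
  \<comment> \<open>The shift by 5 makes both required areas at most the square of the side;
    the binding case is \<^term>\<open>4 * 6 \<le> (5 * 5 :: nat)\<close>.\<close>
  define H C where "H n = R (4 * (n + 6)) (n + 5)" and "C n = R (4 * (n + 5)) (n + 6)" for n
  have H: "parallelogram (H n)" "heronian (H n)" "area (H n) = 4 * (n + 6)" "perimeter (H n) = 4 * (n + 5)" for n
    using R[of "4 * (n + 6)" "n + 5"] by (simp_all add: H_def algebra_simps)
  have C: "parallelogram (C n)" "heronian (C n)" "area (C n) = 4 * (n + 5)" "perimeter (C n) = 4 * (n + 6)" for n
    using R[of "4 * (n + 5)" "n + 6"] by (simp_all add: C_def algebra_simps)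
  define S where "S = range (\<lambda>n. (H n, C n))"
  have "inj (\<lambda>n. (H n, C n))"
  proof (rule injI)
    fix m n assume "(H m, C m) = (H n, C n)"
    then have "area (H m) = area (H n)" by simp
    then show "m = n" by (simp add: H)
  qed
  then have "infinite S"
    unfolding S_def by (simp add: finite_image_iff)
  moreover have "pairwise (\<lambda>p q. \<not> congruent_pairs p q) S"
  proof -
    have "m = n" if "congruent_pairs (H m, C m) (H n, C n)" for m n
    proof -
      have "area (H m) = area (H n)"
        using that by (simp add: congruent_pairs_def congruent_polygons_area_eq)
      then show ?thesis by (simp add: H)
    qed
    then show ?thesis
      by (auto simp: pairwise_def S_def)
  qed
  moreover have "\<not> congruent_polygons (H n) (C n)" for n
    using congruent_polygons_area_eq[of "H n" "C n"] by (auto simp: H C)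
  then have "\<forall>(H, C) \<in> S. parallelogram H \<and> heronian H \<and> parallelogram C \<and> heronian C \<and>
      \<not> congruent_polygons H C \<and> amicable H C"
    by (auto simp: S_def H C amicable_def)
  ultimately show ?thesis by blast
qed

end
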